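(* Let $\sigma>0,\lambda>0,\rho>0$ satisfy $\rho^{-2}\sigma<1$ and $\rho\le\lambda-2\rho^{-1}\sigma(1-\rho^{-2}\sigma)^{-1}$. Let $\Omega=\begin{bmatrix}\Omega^{11}&\Omega^{12}\\\Omega^{21}&\Omega^{22}\end{bmatrix}\in\mathbb{R}^{2n\times2n}$ be symmetric (so $(\Omega^{12})^T=\Omega^{21}$) with $\Omega^{11}+\Omega^{22}>0$, and suppose $$\Omega^{12}\Omega^{21}\le\sigma I,\quad\Omega^{21}\Omega^{12}\le\sigma I,\quad\Omega^{11}+\Omega^{22}\ge\lambda I.$$ Define $\Omega_1=\Omega$ and $\Omega_{k+1}=\Omega_k\circledast\Omega_k$. Then $\Omega^{11}_k+\Omega^{22}_k\ge\rho I$ for all $k\in\mathbb{Z}_{>0}$, and there is a block diagonal matrix $\Omega_\infty=\operatorname{diag}(\Omega^{11}_\infty,\Omega^{22}_\infty)$ with $\Omega^{11}_\infty+\Omega^{22}_\infty\ge\rho I$ such that $\Omega_k\to\Omega_\infty$ as $k\to\infty$.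
   Context: For symmetric $\Omega_1,\Omega_2\in\mathbb{R}^{2n\times2n}$ partitioned into $n\times n$ blocks $\Omega_j^{ab}$, with $\Omega_1^{22}+\Omega_2^{11}>0$, define $$\Omega_1\circledast\Omega_2=\begin{bmatrix}\Omega_1^{11}&0\\0&\Omega_2^{22}\end{bmatrix}-\begin{bmatrix}\Omega_1^{12}\\\Omega_2^{21}\end{bmatrix}(\Omega_1^{22}+\Omega_2^{11})^{-1}\begin{bmatrix}\Omega_1^{21}&\Omega_2^{12}\end{bmatrix}.$$ Matrix inequalities are in the positive semidefinite order. *)

theory Defs
  imports "HOL-Analysis.Analysis"
begin

text \<open>A 2n x 2n real matrix is represented with row/column index type 'n + 'n,
  where Inl i is the i-th index of the first block and Inr i of the second.\<close>

definition blk11 :: "real^('n::finite + 'n)^('n + 'n) \<Rightarrow> real^'n^'n" where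
  "blk11 M = (\<chi> i j. M $ Inl i $ Inl j)"
definition blk12 :: "real^('n::finite + 'n)^('n + 'n) \<Rightarrow> real^'n^'n" where
  "blk12 M = (\<chi> i j. M $ Inl i $ Inr j)"
definition blk21 :: "real^('n::finite + 'n)^('n + 'n) \<Rightarrow> real^'n^'n" where
  "blk21 M = (\<chi> i j. M $ Inr i $ Inl j)"
definition blk22 :: "real^('n::finite + 'n)^('n + 'n) \<Rightarrow> real^'n^'n" where
  "blk22 M = (\<chi> i j. M $ Inr i $ Inr j)"

definition blocks :: "real^'n^'n \<Rightarrow> real^'n^'n \<Rightarrow> real^'n^'n \<Rightarrow> real^'n^'n
    \<Rightarrow> real^('n::finite + 'n)^('n + 'n)" where
  "blocks A B C D = (\<chi> i j. case i of
      Inl a \<Rightarrow> (case j of Inl b \<Rightarrow> A $ a $ b | Inr b \<Rightarrow> B $ a $ b)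
    | Inr a \<Rightarrow> (case j of Inl b \<Rightarrow> C $ a $ b | Inr b \<Rightarrow> D $ a $ b))"

text \<open>Positive semidefinite order A \<le> B (B - A is PSD) and positive definiteness.\<close>
definition psd_le :: "real^'n^'n \<Rightarrow> real^'n^'n \<Rightarrow> bool" where
  "psd_le A B \<longleftrightarrow> (\<forall>x. 0 \<le> x \<bullet> ((B - A) *v x))"

definition pos_def :: "real^'n^'n \<Rightarrow> bool" where
  "pos_def A \<longleftrightarrow> (\<forall>x. x \<noteq> 0 \<longrightarrow> 0 < x \<bullet> (A *v x))"

definition star_prod :: "real^('n::finite + 'n)^('n + 'n) \<Rightarrow> real^('n + 'n)^('n + 'n)
    \<Rightarrow> real^('n + 'n)^('n + 'n)" (infixl "\<circledast>" 70) where
  "star_prod O1 O2 =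
    (let G = matrix_inv (blk22 O1 + blk11 O2) in
     blocks (blk11 O1 - blk12 O1 ** G ** blk21 O1)
            (- (blk12 O1 ** G ** blk12 O2))
            (- (blk21 O2 ** G ** blk21 O1))
            (blk22 O2 - blk21 O2 ** G ** blk12 O2))"

text \<open>Omega_seq Om k is the paper's Omega_k (meaningful for k \<ge> 1):
  Omega_1 = Om, Omega_{k+1} = Omega_k \<circledast> Omega_k.\<close>
definition Omega_seq :: "real^('n::finite + 'n)^('n + 'n) \<Rightarrow> nat \<Rightarrow> real^('n + 'n)^('n + 'n)" where
  "Omega_seq Om k = ((\<lambda>M. M \<circledast> M) ^^ (k - 1)) Om"

end

theory Submission
  imports Defs
begin

text \<open>Put r = sqrt \<sigma> / \<rho> < 1. If the off-diagonal blocks of M have operator norm at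
  most c and M11 + M22 \<ge> m I with m \<ge> \<rho>, then the inverse occurring in M \<circledast> M has norm at
  most 1/\<rho>, so each block of M \<circledast> M differs from the corresponding block of diag(M11, M22)
  by at most c^2/\<rho>. Iterating, the off-diagonal blocks of the k-th iterate are bounded by the
  doubly exponentially decaying c_k = \<rho> r^(2^k), while the lower bound of the diagonal sum
  loses 2 c_(k+1) per step, in total at most 2 \<rho> r^2 / (1 - r^2); this is exactly what the
  hypothesis on \<rho> pays for. The increments being summable, the iterates converge, and the
  off-diagonal blocks of the limit vanish.\<close>

lemma blk_blocks [simp]:
  "blk11 (blocks A B C D) = A" "blk12 (blocks A B C D) = B"
  "blk21 (blocks A B C D) = C" "blk22 (blocks A B C D) = D"
  by (simp_all add: blk11_def blk12_def blk21_def blk22_def blocks_def vec_eq_iff)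

lemma blk21_eq_transpose_blk12:
  assumes "transpose M = M"
  shows "blk21 M = transpose (blk12 M)"
proof -
  have "M $ i $ j = M $ j $ i" for i j
    using arg_cong[OF assms, of "\<lambda>A. A $ i $ j"] by (simp add: transpose_def)
  then show ?thesis by (simp add: vec_eq_iff blk21_def blk12_def transpose_def)
qed

lemma scaleR_mat_1_mult_vector [simp]: "(c *\<^sub>R mat 1) *v x = c *\<^sub>R (x :: real^'n)"
  by (metis scaleR_matrix_vector_assoc matrix_vector_mul_lid)

lemma psd_le_scaleR_mat_1_left:
  "psd_le (c *\<^sub>R mat 1) A \<longleftrightarrow> (\<forall>x. c * norm x ^ 2 \<le> x \<bullet> (A *v x))"
  by (simp add: psd_le_def matrix_vector_mult_diff_rdistrib inner_diff_right
      power2_norm_eq_inner)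

lemma psd_le_scaleR_mat_1_right:
  "psd_le A (c *\<^sub>R mat 1) \<longleftrightarrow> (\<forall>x. x \<bullet> (A *v x) \<le> c * norm x ^ 2)"
  by (simp add: psd_le_def matrix_vector_mult_diff_rdistrib inner_diff_right
      power2_norm_eq_inner)

lemma psd_le_scaleR_mat_1_mono:
  assumes "psd_le (a *\<^sub>R mat 1) A" and "b \<le> a"
  shows "psd_le (b *\<^sub>R mat 1) A"
proof -
  have "b * norm x ^ 2 \<le> a * norm x ^ 2" for x :: "real^'n"
    using assms(2) by (simp add: mult_right_mono)
  then show ?thesis using assms(1) by (meson order_trans psd_le_scaleR_mat_1_left)
qed

lemma onorm_matrix_uminus: "onorm ((*v) (- A)) = onorm ((*v) (A :: real^'n^'m))"
proof -
  have "(*v) (- A) = (\<lambda>x. - (A *v x))"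
    by (simp add: fun_eq_iff vec_eq_iff matrix_vector_mult_def sum_negf)
  then show ?thesis by (simp add: onorm_neg)
qed

lemma onorm_matrix_mul_le:
  fixes A :: "real^'n^'m" and B :: "real^'k^'n"
  shows "onorm ((*v) (A ** B)) \<le> onorm ((*v) A) * onorm ((*v) B)"
proof -
  have "(*v) (A ** B) = (*v) A \<circ> (*v) B"
    by (simp add: fun_eq_iff matrix_vector_mul_assoc)
  then show ?thesis by (simp add: onorm_compose)
qed

lemma inner_matrix_vector_le_onorm:
  fixes A :: "real^'n^'n"
  shows "x \<bullet> (A *v x) \<le> onorm ((*v) A) * norm x ^ 2"
proof -
  have "x \<bullet> (A *v x) \<le> norm x * norm (A *v x)" by (rule norm_cauchy_schwarz)
  also have "\<dots> \<le> norm x * (onorm ((*v) A) * norm x)"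
    by (intro mult_left_mono onorm) simp_all
  finally show ?thesis by (simp add: power2_eq_square mult_ac)
qed

lemma onorm_le_sqrt_if_psd_le:
  fixes A :: "real^'n^'m"
  assumes "psd_le (transpose A ** A) (\<sigma> *\<^sub>R mat 1)"
  shows "onorm ((*v) A) \<le> sqrt \<sigma>"
proof (rule onorm_le)
  fix x
  have "norm (A *v x) ^ 2 = (x v* transpose A) \<bullet> (A *v x)"
    unfolding power2_norm_eq_inner vector_transpose_matrix ..
  also have "\<dots> = x \<bullet> ((transpose A ** A) *v x)"
    by (simp only: dot_lmul_matrix matrix_vector_mul_assoc)
  also have "\<dots> \<le> \<sigma> * norm x ^ 2"
    using assms by (simp add: psd_le_scaleR_mat_1_right)
  finally have "sqrt (norm (A *v x) ^ 2) \<le> sqrt (\<sigma> * norm x ^ 2)"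
    by (rule real_sqrt_le_mono)
  then show "norm (A *v x) \<le> sqrt \<sigma> * norm x"
    by (simp add: real_sqrt_mult)
qed

lemma onorm_matrix_inv_le:
  fixes S :: "real^'n^'n"
  assumes m: "0 < m" and S: "psd_le (m *\<^sub>R mat 1) S"
  shows "onorm ((*v) (matrix_inv S)) \<le> 1 / m"
proof (rule onorm_le)
  have coercive: "m * norm x ^ 2 \<le> x \<bullet> (S *v x)" for x
    using S by (simp add: psd_le_scaleR_mat_1_left)
  have "\<forall>x. S *v x = 0 \<longrightarrow> x = 0"
  proof (intro allI impI)
    fix x assume "S *v x = 0"
    then have "m * norm x ^ 2 \<le> 0" using coercive[of x] by simp
    then show "x = 0" using m by (simp add: mult_le_0_iff)
  qed
  then obtain B where "B ** S = mat 1" using matrix_left_invertible_ker by blast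
  then have "S ** B = mat 1 \<and> B ** S = mat 1" using matrix_left_right_inverse by blast
  then have "S ** matrix_inv S = mat 1 \<and> matrix_inv S ** S = mat 1"
    unfolding matrix_inv_def by (rule someI)
  then have S_inv: "S *v (matrix_inv S *v y) = y" for y
    by (simp add: matrix_vector_mul_assoc)
  fix y
  define z where "z = matrix_inv S *v y"
  have "m * norm z ^ 2 \<le> norm z * norm y"
    using coercive[of z] norm_cauchy_schwarz[of z y] by (simp add: S_inv z_def)
  then have "m * norm z \<le> norm y"
    by (cases "z = 0") (simp_all add: power2_eq_square)
  then show "norm (matrix_inv S *v y) \<le> 1 / m * norm y"
    using m by (simp add: z_def field_simps)
qed

lemma onorm_matrix_triple_le:
  fixes X G Y :: "real^'n^'n"
  assumes X: "onorm ((*v) X) \<le> c" and G: "onorm ((*v) G) \<le> 1 / \<rho>"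
    and Y: "onorm ((*v) Y) \<le> c" and \<rho>: "0 < \<rho>"
  shows "onorm ((*v) (X ** G ** Y)) \<le> c\<^sup>2 / \<rho>"
proof -
  have c: "0 \<le> c" using X onorm_pos_le[of "(*v) X"] by simp
  have "onorm ((*v) (X ** G ** Y)) \<le> onorm ((*v) (X ** G)) * onorm ((*v) Y)"
    by (rule onorm_matrix_mul_le)
  also have "\<dots> \<le> onorm ((*v) X) * onorm ((*v) G) * onorm ((*v) Y)"
    by (intro mult_right_mono onorm_matrix_mul_le onorm_pos_le) simp
  also have "\<dots> \<le> c * (1 / \<rho>) * c"
    by (intro mult_mono X Y G c onorm_pos_le matrix_vector_mul_bounded_linear)
      (use \<rho> c in simp_all)
  finally show ?thesis by (simp add: power2_eq_square)
qed

lemma star_prod_self_bounds: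
  fixes M :: "real^('n::finite + 'n)^('n + 'n)"
  assumes \<rho>: "0 < \<rho>" "\<rho> \<le> m"
    and B: "onorm ((*v) (blk12 M)) \<le> c" and C: "onorm ((*v) (blk21 M)) \<le> c"
    and S: "psd_le (m *\<^sub>R mat 1) (blk11 M + blk22 M)"
  shows "onorm ((*v) (blk12 (M \<circledast> M))) \<le> c\<^sup>2 / \<rho>"
    and "onorm ((*v) (blk21 (M \<circledast> M))) \<le> c\<^sup>2 / \<rho>"
    and "onorm ((*v) (blk11 (M \<circledast> M) - blk11 M)) \<le> c\<^sup>2 / \<rho>"
    and "onorm ((*v) (blk22 (M \<circledast> M) - blk22 M)) \<le> c\<^sup>2 / \<rho>"
    and "psd_le ((m - 2 * c\<^sup>2 / \<rho>) *\<^sub>R mat 1) (blk11 (M \<circledast> M) + blk22 (M \<circledast> M))"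
proof -
  define G where "G = matrix_inv (blk11 M + blk22 M)"
  have "onorm ((*v) G) \<le> 1 / m"
    unfolding G_def using \<rho> S by (intro onorm_matrix_inv_le) auto
  also have "\<dots> \<le> 1 / \<rho>" using \<rho> by (simp add: frac_le)
  finally have G: "onorm ((*v) G) \<le> 1 / \<rho>" .
  note product = onorm_matrix_triple_le[OF _ G _ \<rho>(1)]
  have MM: "M \<circledast> M =
      blocks (blk11 M - blk12 M ** G ** blk21 M) (- (blk12 M ** G ** blk12 M))
             (- (blk21 M ** G ** blk21 M)) (blk22 M - blk21 M ** G ** blk12 M)"
    by (simp add: star_prod_def G_def Let_def add.commute)
  show "onorm ((*v) (blk12 (M \<circledast> M))) \<le> c\<^sup>2 / \<rho>"
    and "onorm ((*v) (blk21 (M \<circledast> M))) \<le> c\<^sup>2 / \<rho>"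
    and "onorm ((*v) (blk11 (M \<circledast> M) - blk11 M)) \<le> c\<^sup>2 / \<rho>"
    and "onorm ((*v) (blk22 (M \<circledast> M) - blk22 M)) \<le> c\<^sup>2 / \<rho>"
    unfolding MM using product B C by (simp_all add: onorm_matrix_uminus)
  have form: "x \<bullet> ((X ** G ** Y) *v x) \<le> c\<^sup>2 / \<rho> * norm x ^ 2"
    if "onorm ((*v) X) \<le> c" "onorm ((*v) Y) \<le> c" for X Y :: "real^'n^'n" and x
    using inner_matrix_vector_le_onorm[of x "X ** G ** Y"]
      mult_right_mono[OF product[OF that] zero_le_power2[of "norm x"]]
    by linarith
  have "(m - 2 * c\<^sup>2 / \<rho>) * norm x ^ 2 \<le> x \<bullet> ((blk11 (M \<circledast> M) + blk22 (M \<circledast> M)) *v x)"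
    for x
  proof -
    have "x \<bullet> ((blk11 (M \<circledast> M) + blk22 (M \<circledast> M)) *v x)
        = x \<bullet> ((blk11 M + blk22 M) *v x) - x \<bullet> ((blk12 M ** G ** blk21 M) *v x)
          - x \<bullet> ((blk21 M ** G ** blk12 M) *v x)"
      unfolding MM by (simp add: matrix_vector_mult_diff_rdistrib matrix_vector_mult_add_rdistrib
          inner_diff_right inner_add_right)
    moreover have "m * norm x ^ 2 \<le> x \<bullet> ((blk11 M + blk22 M) *v x)"
      using S by (simp add: psd_le_scaleR_mat_1_left)
    moreover have "(m - 2 * c\<^sup>2 / \<rho>) * norm x ^ 2
        = m * norm x ^ 2 - c\<^sup>2 / \<rho> * norm x ^ 2 - c\<^sup>2 / \<rho> * norm x ^ 2"
      by (simp add: algebra_simps)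
    ultimately show ?thesis using form[OF B C, of x] form[OF C B, of x] by linarith
  qed
  then show "psd_le ((m - 2 * c\<^sup>2 / \<rho>) *\<^sub>R mat 1) (blk11 (M \<circledast> M) + blk22 (M \<circledast> M))"
    by (simp add: psd_le_scaleR_mat_1_left)
qed

lemma power_two_power_Suc_le:
  fixes r :: real
  assumes "0 \<le> r" "r \<le> 1"
  shows "r ^ 2 ^ Suc j \<le> (r\<^sup>2) ^ Suc j"
proof -
  have "Suc j \<le> 2 ^ j" by (rule Suc_leI[OF less_exp])
  then have "2 * Suc j \<le> 2 ^ Suc j" by simp
  then have "r ^ 2 ^ Suc j \<le> r ^ (2 * Suc j)" using assms by (intro power_decreasing)
  then show ?thesis by (simp only: power_mult)
qed

lemma sum_power_two_power_le:
  fixes r :: real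
  assumes "0 \<le> r" "r < 1"
  shows "(\<Sum>j<k. r ^ 2 ^ Suc j) \<le> r\<^sup>2 / (1 - r\<^sup>2)"
proof -
  have q: "0 \<le> r\<^sup>2" "r\<^sup>2 < 1" using assms by (simp_all add: power_less_one_iff)
  have "(\<Sum>j<k. r ^ 2 ^ Suc j) \<le> (\<Sum>j<k. (r\<^sup>2) ^ Suc j)"
    using assms by (intro sum_mono power_two_power_Suc_le) simp_all
  also have "\<dots> = r\<^sup>2 * (1 - (r\<^sup>2) ^ k) / (1 - r\<^sup>2)"
    using q by (simp add: sum_distrib_left[symmetric] sum_gp_strict)
  also have "\<dots> \<le> r\<^sup>2 / (1 - r\<^sup>2)"
    using q by (intro divide_right_mono) (simp_all add: mult_left_le)
  finally show ?thesis .
qed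

lemma summable_power_two_power:
  fixes r :: real
  assumes "0 \<le> r" "r < 1"
  shows "summable (\<lambda>k. r ^ 2 ^ k)"
proof (rule summable_comparison_test')
  show "summable (\<lambda>k. r ^ k)" using assms by simp
  show "norm (r ^ 2 ^ k) \<le> r ^ k" for k
    using assms by (simp add: power_decreasing less_imp_le_nat)
qed

lemma star_iterate_bounds:
  fixes W :: "nat \<Rightarrow> real^('n::finite + 'n)^('n + 'n)"
  assumes W_Suc: "\<And>k. W (Suc k) = W k \<circledast> W k"
    and \<rho>: "0 < \<rho>" and r: "0 \<le> r" "r < 1"
    and B0: "onorm ((*v) (blk12 (W 0))) \<le> \<rho> * r"
    and C0: "onorm ((*v) (blk21 (W 0))) \<le> \<rho> * r"
    and S0: "psd_le (lam *\<^sub>R mat 1) (blk11 (W 0) + blk22 (W 0))"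
    and lam: "\<rho> \<le> lam - 2 * \<rho> * r\<^sup>2 / (1 - r\<^sup>2)"
  shows "onorm ((*v) (blk12 (W k))) \<le> \<rho> * r ^ 2 ^ k"
    and "onorm ((*v) (blk21 (W k))) \<le> \<rho> * r ^ 2 ^ k"
    and "psd_le (\<rho> *\<^sub>R mat 1) (blk11 (W k) + blk22 (W k))"
    and "onorm ((*v) (blk11 (W (Suc k)) - blk11 (W k))) \<le> \<rho> * r ^ 2 ^ Suc k"
    and "onorm ((*v) (blk22 (W (Suc k)) - blk22 (W k))) \<le> \<rho> * r ^ 2 ^ Suc k"
proof -
  define c where "c k = \<rho> * r ^ 2 ^ k" for k
  define m where "m k = lam - 2 * \<rho> * (\<Sum>j<k. r ^ 2 ^ Suc j)" for k
  have c_Suc: "(c k)\<^sup>2 / \<rho> = c (Suc k)" for k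
    using \<rho> by (simp add: c_def power2_eq_square power_mult_distrib power_add[symmetric] mult_2)
  have m_Suc: "m (Suc k) = m k - 2 * (c k)\<^sup>2 / \<rho>" for k
  proof -
    have "m (Suc k) = m k - 2 * c (Suc k)" by (simp add: m_def c_def algebra_simps)
    then show ?thesis by (simp add: c_Suc[symmetric])
  qed
  have m_ge: "\<rho> \<le> m k" for k
  proof -
    have "2 * \<rho> * (\<Sum>j<k. r ^ 2 ^ Suc j) \<le> 2 * \<rho> * (r\<^sup>2 / (1 - r\<^sup>2))"
      using \<rho> r by (intro mult_left_mono sum_power_two_power_le) simp_all
    then show ?thesis using lam by (simp add: m_def)
  qed
  have invariant: "onorm ((*v) (blk12 (W k))) \<le> c k \<and> onorm ((*v) (blk21 (W k))) \<le> c k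
      \<and> psd_le (m k *\<^sub>R mat 1) (blk11 (W k) + blk22 (W k))" for k
  proof (induction k)
    case 0
    then show ?case using B0 C0 S0 by (simp add: c_def m_def)
  next
    case (Suc k)
    then have "onorm ((*v) (blk12 (W k))) \<le> c k" "onorm ((*v) (blk21 (W k))) \<le> c k"
      "psd_le (m k *\<^sub>R mat 1) (blk11 (W k) + blk22 (W k))" by auto
    from star_prod_self_bounds(1,2,5)[OF \<rho> m_ge this] show ?case
      by (simp add: W_Suc m_Suc c_Suc)
  qed
  then have B: "onorm ((*v) (blk12 (W k))) \<le> c k" and C: "onorm ((*v) (blk21 (W k))) \<le> c k"
    and S: "psd_le (m k *\<^sub>R mat 1) (blk11 (W k) + blk22 (W k))" by auto
  from B C show "onorm ((*v) (blk12 (W k))) \<le> \<rho> * r ^ 2 ^ k"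
    and "onorm ((*v) (blk21 (W k))) \<le> \<rho> * r ^ 2 ^ k"
    by (simp_all add: c_def)
  from S m_ge show "psd_le (\<rho> *\<^sub>R mat 1) (blk11 (W k) + blk22 (W k))"
    by (rule psd_le_scaleR_mat_1_mono)
  from star_prod_self_bounds(3,4)[OF \<rho> m_ge B C S]
  show "onorm ((*v) (blk11 (W (Suc k)) - blk11 (W k))) \<le> \<rho> * r ^ 2 ^ Suc k"
    and "onorm ((*v) (blk22 (W (Suc k)) - blk22 (W k))) \<le> \<rho> * r ^ 2 ^ Suc k"
    unfolding c_Suc by (simp_all add: W_Suc c_def)
qed

lemma convergent_if_norm_diff_summable:
  fixes f :: "nat \<Rightarrow> 'a::banach"
  assumes "\<And>k. norm (f (Suc k) - f k) \<le> g k" and "summable g"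
  shows "convergent f"
proof -
  have "summable (\<lambda>k. f (Suc k) - f k)"
    by (rule summable_comparison_test'[OF assms(2)]) (use assms(1) in simp)
  then have "(\<lambda>n. \<Sum>k<n. f (Suc k) - f k) \<longlonglongrightarrow> (\<Sum>k. f (Suc k) - f k)"
    by (rule summable_LIMSEQ)
  then have "(\<lambda>n. (f n - f 0) + f 0) \<longlonglongrightarrow> (\<Sum>k. f (Suc k) - f k) + f 0"
    by (intro tendsto_add tendsto_const) (simp add: sum_lessThan_telescope)
  then show ?thesis by (auto simp: convergent_def)
qed

lemma norm_le_matrix_component:
  fixes A :: "real^'n^'m"
  assumes "\<And>i j. \<bar>A $ i $ j\<bar> \<le> b"
  shows "norm A \<le> real CARD('m) * real CARD('n) * b"
proof -
  have "norm A \<le> (\<Sum>i\<in>UNIV. norm (A $ i))"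
    unfolding norm_vec_def by (rule L2_set_le_sum) simp
  also have "\<dots> \<le> (\<Sum>i\<in>UNIV. \<Sum>j\<in>UNIV. \<bar>A $ i $ j\<bar>)"
    by (intro sum_mono norm_le_l1_cart)
  also have "\<dots> \<le> (\<Sum>i::'m\<in>UNIV. \<Sum>j::'n\<in>UNIV. b)"
    by (intro sum_mono assms)
  finally show ?thesis by simp
qed

lemma psd_le_limit:
  assumes "\<And>k. psd_le A (B k)" and "B \<longlonglongrightarrow> L"
  shows "psd_le A L"
  unfolding psd_le_def
proof
  fix x
  have "(\<lambda>k. x \<bullet> ((B k - A) *v x)) \<longlonglongrightarrow> x \<bullet> ((L - A) *v x)"
    unfolding inner_vec_def matrix_vector_mult_def
    by (simp only: vec_lambda_beta) (intro tendsto_intros assms(2))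
  then show "0 \<le> x \<bullet> ((L - A) *v x)"
    by (rule LIMSEQ_le_const) (use assms(1) in \<open>auto simp: psd_le_def\<close>)
qed

lemma tendsto_blk11_add_blk22:
  assumes "(f \<longlongrightarrow> L) F"
  shows "((\<lambda>t. blk11 (f t) + blk22 (f t)) \<longlongrightarrow> blk11 L + blk22 L) F"
  by (intro vec_tendstoI) (simp add: blk11_def blk22_def tendsto_intros assms)

lemma abs_component_increment_le:
  fixes M N :: "real^('n::finite + 'n)^('n + 'n)"
  assumes M12: "onorm ((*v) (blk12 M)) \<le> a" and M21: "onorm ((*v) (blk21 M)) \<le> a"
    and N12: "onorm ((*v) (blk12 N)) \<le> b" and N21: "onorm ((*v) (blk21 N)) \<le> b"
    and D11: "onorm ((*v) (blk11 N - blk11 M)) \<le> b"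
    and D22: "onorm ((*v) (blk22 N - blk22 M)) \<le> b"
  shows "\<bar>N $ i $ j - M $ i $ j\<bar> \<le> a + b"
proof -
  have "0 \<le> a" using onorm_pos_le[of "(*v) (blk12 M)"] M12 by simp
  have component: "\<bar>X $ p $ q\<bar> \<le> e" if "onorm ((*v) X) \<le> e" for X :: "real^'n^'n" and e p q
    using matrix_component_le_onorm[of X p q] that by linarith
  show ?thesis
  proof (cases i; cases j)
    fix p q assume ij: "i = Inl p" "j = Inl q"
    show ?thesis using component[OF D11, of p q] \<open>0 \<le> a\<close> by (simp add: ij blk11_def)
  next
    fix p q assume ij: "i = Inl p" "j = Inr q"
    show ?thesis
      using component[OF N12, of p q] component[OF M12, of p q]
        abs_triangle_ineq4[of "N $ i $ j" "M $ i $ j"] by (simp add: ij blk12_def)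
  next
    fix p q assume ij: "i = Inr p" "j = Inl q"
    show ?thesis
      using component[OF N21, of p q] component[OF M21, of p q]
        abs_triangle_ineq4[of "N $ i $ j" "M $ i $ j"] by (simp add: ij blk21_def)
  next
    fix p q assume ij: "i = Inr p" "j = Inr q"
    show ?thesis using component[OF D22, of p q] \<open>0 \<le> a\<close> by (simp add: ij blk22_def)
  qed
qed

lemma block_diagonal_limit:
  fixes W :: "nat \<Rightarrow> real^('n::finite + 'n)^('n + 'n)"
  assumes c: "summable c"
    and B: "\<And>k. onorm ((*v) (blk12 (W k))) \<le> c k"
    and C: "\<And>k. onorm ((*v) (blk21 (W k))) \<le> c k"
    and D1: "\<And>k. onorm ((*v) (blk11 (W (Suc k)) - blk11 (W k))) \<le> c (Suc k)"
    and D2: "\<And>k. onorm ((*v) (blk22 (W (Suc k)) - blk22 (W k))) \<le> c (Suc k)"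
    and S: "\<And>k. psd_le A (blk11 (W k) + blk22 (W k))"
  shows "\<exists>L. blk12 L = 0 \<and> blk21 L = 0 \<and> psd_le A (blk11 L + blk22 L) \<and> W \<longlonglongrightarrow> L"
proof -
  have "\<bar>W (Suc k) $ i $ j - W k $ i $ j\<bar> \<le> c k + c (Suc k)" for k i j
    by (rule abs_component_increment_le[OF B C B C D1 D2])
  then have "norm (W (Suc k) - W k) \<le> real CARD('n + 'n) * real CARD('n + 'n) * (c k + c (Suc k))"
    for k by (intro norm_le_matrix_component) simp
  moreover have "summable (\<lambda>k. real CARD('n + 'n) * real CARD('n + 'n) * (c k + c (Suc k)))"
    using c by (intro summable_mult summable_add) (simp_all add: summable_Suc_iff)
  ultimately have "convergent W" by (rule convergent_if_norm_diff_summable)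
  then obtain L where L: "W \<longlonglongrightarrow> L" unfolding convergent_def by blast
  have "c \<longlonglongrightarrow> 0" by (rule summable_LIMSEQ_zero[OF c])
  have vanishing_entry: "L $ i $ j = 0" if "\<And>k. \<bar>W k $ i $ j\<bar> \<le> c k" for i j
  proof -
    have "(\<lambda>k. W k $ i $ j) \<longlonglongrightarrow> 0"
      by (rule Lim_null_comparison[OF _ \<open>c \<longlonglongrightarrow> 0\<close>]) (simp add: that)
    moreover have "(\<lambda>k. W k $ i $ j) \<longlonglongrightarrow> L $ i $ j" by (intro tendsto_intros L)
    ultimately show ?thesis using LIMSEQ_unique by blast
  qed
  have "\<bar>W k $ Inl p $ Inr q\<bar> \<le> c k" "\<bar>W k $ Inr p $ Inl q\<bar> \<le> c k" for k p q
    using matrix_component_le_onorm[of "blk12 (W k)" p q] B[of k]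
      matrix_component_le_onorm[of "blk21 (W k)" p q] C[of k]
    by (simp_all add: blk12_def blk21_def)
  then have "blk12 L = 0" "blk21 L = 0"
    using vanishing_entry by (simp_all add: vec_eq_iff blk12_def blk21_def)
  moreover have "psd_le A (blk11 L + blk22 L)"
    using S tendsto_blk11_add_blk22[OF L] by (rule psd_le_limit)
  ultimately show ?thesis using L by blast
qed

theorem theorem4p2:
  fixes \<sigma> lam \<rho> :: real and Om :: "real^('n::finite + 'n)^('n + 'n)"
  assumes "\<sigma> > 0" "lam > 0" "\<rho> > 0"
    and "\<sigma> / \<rho>^2 < 1"
    and "\<rho> \<le> lam - 2 * (\<sigma> / \<rho>) / (1 - \<sigma> / \<rho>^2)"
    and "transpose Om = Om"
    and "pos_def (blk11 Om + blk22 Om)"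
    and "psd_le (blk12 Om ** blk21 Om) (\<sigma> *\<^sub>R mat 1)"
    and "psd_le (blk21 Om ** blk12 Om) (\<sigma> *\<^sub>R mat 1)"
    and "psd_le (lam *\<^sub>R mat 1) (blk11 Om + blk22 Om)"
  shows "(\<forall>k>0. psd_le (\<rho> *\<^sub>R mat 1) (blk11 (Omega_seq Om k) + blk22 (Omega_seq Om k)))
       \<and> (\<exists>Oinf. blk12 Oinf = 0 \<and> blk21 Oinf = 0
             \<and> psd_le (\<rho> *\<^sub>R mat 1) (blk11 Oinf + blk22 Oinf)
             \<and> (\<lambda>k. Omega_seq Om k) \<longlonglongrightarrow> Oinf)"
proof -
  define r where "r = sqrt \<sigma> / \<rho>"
  have r2: "r\<^sup>2 = \<sigma> / \<rho>\<^sup>2" using assms(1) by (simp add: r_def power_divide)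
  have r: "0 \<le> r" "r < 1"
    using assms(1,3,4) r2 abs_square_less_1[of r] by (simp_all add: r_def)
  define W where "W k = Omega_seq Om (Suc k)" for k
  have W_Suc: "W (Suc k) = W k \<circledast> W k" for k by (simp add: W_def Omega_seq_def)
  have W_0: "W 0 = Om" by (simp add: W_def Omega_seq_def)
  have sqrt_\<sigma>: "sqrt \<sigma> = \<rho> * r" using assms(3) by (simp add: r_def)
  have "blk21 Om = transpose (blk12 Om)" by (rule blk21_eq_transpose_blk12[OF assms(6)])
  then have B0: "onorm ((*v) (blk12 (W 0))) \<le> \<rho> * r"
    and C0: "onorm ((*v) (blk21 (W 0))) \<le> \<rho> * r"
    using onorm_le_sqrt_if_psd_le[of "blk12 Om" \<sigma>] onorm_le_sqrt_if_psd_le[of "blk21 Om" \<sigma>]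
      assms(8,9) by (simp_all add: W_0 sqrt_\<sigma>)
  have \<rho>_r2: "\<rho> * r\<^sup>2 = \<sigma> / \<rho>"
    unfolding r2 using assms(3) by (simp add: power2_eq_square)
  have "2 * \<rho> * r\<^sup>2 / (1 - r\<^sup>2) = 2 * (\<sigma> / \<rho>) / (1 - \<sigma> / \<rho>^2)"
    unfolding r2[symmetric] \<rho>_r2[symmetric] mult.assoc ..
  then have lam: "\<rho> \<le> lam - 2 * \<rho> * r\<^sup>2 / (1 - r\<^sup>2)" using assms(5) by simp
  note bounds = star_iterate_bounds[OF W_Suc assms(3) r B0 C0 _ lam, unfolded W_0, OF assms(10)]
  have "summable (\<lambda>k. \<rho> * r ^ 2 ^ k)" by (intro summable_mult summable_power_two_power r)
  then obtain L where "blk12 L = 0" "blk21 L = 0" "psd_le (\<rho> *\<^sub>R mat 1) (blk11 L + blk22 L)"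
    and "W \<longlonglongrightarrow> L"
    using block_diagonal_limit[of "\<lambda>k. \<rho> * r ^ 2 ^ k" W] bounds by blast
  moreover from \<open>W \<longlonglongrightarrow> L\<close> have "(\<lambda>k. Omega_seq Om k) \<longlonglongrightarrow> L"
    unfolding W_def by (rule filterlim_sequentially_Suc[THEN iffD1])
  moreover have "Omega_seq Om k = W (k - 1)" if "k > 0" for k
    using that by (simp add: W_def)
  ultimately show ?thesis using bounds(3) by metis
qed

end
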